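(* Let $M$ be a Riemannian manifold, with or without boundary, $N$ a complete metric space, $1\le p<\infty$ and $f\in W^{1,p}_{loc}(M,N)$, with pushforward data $(\widehat f,\widehat\rho,\widehat\rho_0,\widehat f_\star)$. Let $k\in\{0,1,\dots,\lfloor p\rfloor\}$ and let $\Omega\in\mathcal L_\infty(\mathbf I_k(N))$ have a bounded upper norm $\rho$. Then $$f^\star\Omega\colon\mathbf I_{k,c}(\widehat\rho_0)\to\mathbb R,\qquad f^\star\Omega(T)=\Omega(\widehat f_\star T),$$ is a finite subadditive cochain which has the upper norm $(\rho\circ\widehat f)\,\widehat\rho^{\,k}\in\mathcal L^{p/k}_{loc}(M)$ (that is, $(\rho\circ f)|df|^k$), where $p/0=\infty$ and where $|df|^0$ equals $0$ when $|df|=0$, equals $\infty$ when $|df|=\infty$, and equals $1$ otherwise. If $\Omega$ is additive, so is $f^\star\Omega$.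
   Context: **Currents.** Currents, mass measures $\|T\|$, boundaries, restrictions $T\llcorner E$, Lipschitz pushforwards $\varphi_\sharp T$ and integral currents $\mathbf I_k(N)$ in a complete metric space $N$ are in the sense of Ambrosio–Kirchheim ("Currents in metric spaces", Acta Math. 2000). $\mathbf I_{k,c}(M)$ denotes integral $k$-currents in the Riemannian manifold $M$ whose mass measure is concentrated on a compact set. Standing convention: the cardinality of every set is an Ulam number, so finite Borel measures on complete metric spaces are concentrated on $\sigma$-compact sets. **Reduced complex.** Conventions: $0^0=0$, $\infty^0=\infty$ and $r^0=1$ for $0<r<\infty$. $\mathcal L^p_+(M)$: everywhere nonnegative $p$-integrable functions w.r.t. $\mathcal H^{\dim M}$. For Borel $\rho_0\in\mathcal L^p_+(M)$ and $k\in\{1,\dots,\lfloor p\rfloor\}$, $\mathbf I_{k,c}(\rho_0)$ is the $\mathbb Z$-module of $T\in\mathbf I_{k,c}(M)$ with $\int\rho_0^k\,d\|T\|+\int\rho_0^{k-1}\,d\|\partial T\|<\infty$; $\mathbf I_{0,c}(\rho_0)$ is that of $T\in\mathbf I_{0,c}(M)$ with $\int\rho_0^0\,d\|T\|<\infty$. $\mathbf I_{\star,c}(\rho_0)$ is the direct sum over $0\le k\le\lfloor p\rfloor$. **Sobolev maps.** $M$ carries its length distance and $\mathcal H^{\dim M}$. $W^{1,p}_{loc}(M,N)$ is the metric-valued Sobolev space defined through upper gradients (Heinonen–Koskela–Shanmugalingam–Tyson), with $N$ isometrically embedded in an injective Banach space; $|df|\in L^p_{loc}(M)$ is the minimal $p$-weak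 upper gradient. A Banach space is injective if bounded linear maps into it from subspaces of Banach spaces extend with the same operator norm. **Pushforward data.** For $f\in W^{1,p}_{loc}(M,N)$, pushforward data consist of Borel representatives $\widehat f\colon M\to N$ of $f$ and $\widehat\rho\colon M\to[0,\infty]$ of $|df|$, a Borel $\widehat\rho_0\in\mathcal L^p_+(M)$, and a chain morphism $\widehat f_\star\colon(\mathbf I_{\star,c}(\widehat\rho_0),\partial)\to(\mathbf I_\star(N),\partial)$ (additive in each degree, commuting with $\partial$) such that (i) $\|\widehat f_\star T\|(E)\le\int_{\widehat f^{-1}(E)}\widehat\rho^{\,k}\,d\|T\|<\infty$ for Borel $E\subset N$, $T\in\mathbf I_{k,c}(\widehat\rho_0)$, $0\le k\le\lfloor p\rfloor$; (ii) for every isometric embedding $\iota$ of $N$ into an injective Banach space $\mathbb V$ there are a Borel decomposition $(E_i)_{i\ge0}$ of $M$ with $E_0$ negligible, $E_0\supset\{\widehat\rho_0=\infty\}$, and Lipschitz $f_i\colon M\to\mathbb V$ extending $(\iota\circ\widehat f)|_{E_i}$, $i\ge1$, with $\iota_\sharp(\widehat f_\star T)=\sum_{i\ge1}(f_i)_\sharp(T\llcorner E_i)$ pointwise for all $T\in\mathbf I_{\star,c}(\widehat\rho_0)$. Such data are fixed for $f$, and $(f,|df|)$ is identified with $(\widehat f,\widehat\rho)$. **Cochains.** For a $\mathbb Z$-module $\mathcal C$ of integral $k$-currents in a space $X$, a subadditive cochain is $\Omega\colon\mathcal C\to[-\infty,\infty]$ with $\Omega(0)=0$ and $|\Omega(T)|\le|\Omega(T+S)|+|\Omega(S)|$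 for all $T,S\in\mathcal C$. It is additive if also $\Omega(T+S)=\Omega(T)+\Omega(S)$ whenever all terms are finite, and finite if $\Omega(T)$ is always finite. A Borel $\rho\colon X\to[0,\infty]$ is an upper norm of $\Omega$ if $|\Omega(T)|\le\int_X\rho\,d\|T\|$ for all $T\in\mathcal C$. $\mathcal L_\infty(\mathcal C)$ is the set of subadditive cochains on $\mathcal C$ having a bounded upper norm. *)

theory Defs
  imports
    "HOL-Analysis.Analysis"
    "HOL-Probability.Discrete_Topology"
    "HOL-Library.Function_Algebras"
    "HOL-Combinatorics.Permutations"
begin

section \<open>Conventions on \<open>[0,\<infinity>]\<close> and Ulam numbers\<close>

text \<open>\<open>0\<^sup>0 = 0\<close>, \<open>\<infinity>\<^sup>0 = \<infinity>\<close> and \<open>r\<^sup>0 = 1\<close> for \<open>0 < r < \<infinity>\<close>;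
  the library power has \<open>x ^ 0 = 1\<close> throughout.\<close>

definition epow :: "ennreal \<Rightarrow> nat \<Rightarrow> ennreal" where
  "epow x k = (if k = 0 then (if x = 0 then 0 else if x = \<infinity> then \<infinity> else 1) else x ^ k)"

definition epowr :: "ennreal \<Rightarrow> real \<Rightarrow> ennreal" where
  "epowr x q = (if x = \<infinity> then \<infinity> else ennreal (enn2real x powr q))"

definition ulam_card :: "'a set \<Rightarrow> bool" where
  "ulam_card A \<longleftrightarrow>
    (\<forall>\<mu>. sets \<mu> = Pow A \<and> finite_measure \<mu> \<and> (\<forall>x\<in>A. emeasure \<mu> {x} = 0) \<longrightarrow> emeasure \<mu> A = 0)"


section \<open>Hausdorff measure and local Lebesgue spaces\<close>

text \<open>The empty set contributes \<open>0\<close> also in dimension \<open>0\<close>. The library diameter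
  is meaningful for bounded sets only.\<close>

definition hausdorff_gauge :: "nat \<Rightarrow> 'a::metric_space set \<Rightarrow> ennreal" where
  "hausdorff_gauge n C =
    (if C = {} then 0 else ennreal (unit_ball_vol (real n) * (diameter C / 2) ^ n))"

definition hausdorff_outer :: "nat \<Rightarrow> 'a::metric_space set \<Rightarrow> ennreal" where
  "hausdorff_outer n A =
    (SUP \<delta>\<in>{0<..}. INF C\<in>{C :: nat \<Rightarrow> 'a set.
        A \<subseteq> (\<Union>i. C i) \<and> (\<forall>i. bounded (C i) \<and> diameter (C i) \<le> \<delta>)}.
      (\<Sum>i. hausdorff_gauge n (C i)))"

definition hausdorff_measure :: "nat \<Rightarrow> 'a::metric_space measure" where
  "hausdorff_measure n = measure_of UNIV (sets borel) (hausdorff_outer n)"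

definition Lq_loc :: "'a::metric_space measure \<Rightarrow> ennreal \<Rightarrow> ('a \<Rightarrow> ennreal) \<Rightarrow> bool" where
  "Lq_loc \<mu> q h \<longleftrightarrow> h \<in> borel_measurable (completion \<mu>) \<and>
    (\<forall>x. \<exists>U. open U \<and> x \<in> U \<and>
      (if q = \<infinity> then \<exists>C<\<infinity>. AE y in \<mu>. y \<in> U \<longrightarrow> h y \<le> C
       else (\<integral>\<^sup>+y\<in>U. epowr (h y) (enn2real q) \<partial>completion \<mu>) < \<infinity>))"

definition Lp_plus :: "'a::metric_space measure \<Rightarrow> real \<Rightarrow> ('a \<Rightarrow> ennreal) set" where
  "Lp_plus \<mu> p = {h \<in> borel_measurable (completion \<mu>).
     (\<integral>\<^sup>+x. epowr (h x) p \<partial>completion \<mu>) < \<infinity>}"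


section \<open>Riemannian manifolds with or without boundary\<close>

primrec Ck_on :: "nat \<Rightarrow> ('a::real_normed_vector \<Rightarrow> 'b::real_normed_vector) \<Rightarrow> 'a set \<Rightarrow> bool" where
  "Ck_on 0 f S = continuous_on S f"
| "Ck_on (Suc n) f S =
    (\<exists>f'. (\<forall>x\<in>S. (f has_derivative f' x) (at x)) \<and> (\<forall>v. Ck_on n (\<lambda>x. f' x v) S))"

text \<open>On a set that is not open, smooth means locally extendable to a smooth function.\<close>

definition smooth_on :: "'a set \<Rightarrow> ('a::real_normed_vector \<Rightarrow> 'b::real_normed_vector) \<Rightarrow> bool" where
  "smooth_on S f \<longleftrightarrow> (\<forall>x\<in>S. \<exists>U F. open U \<and> x \<in> U \<and> (\<forall>n. Ck_on n F U) \<and> (\<forall>y\<in>S \<inter> U. F y = f y))"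

definition half_space :: "'e::euclidean_space set" where
  "half_space = {x. 0 \<le> x \<bullet> (SOME b. b \<in> Basis)}"

text \<open>A chart is a pair \<open>(U, \<phi>)\<close>; the values of \<open>\<phi>\<close> outside \<open>U\<close> are irrelevant.\<close>

type_synonym ('m, 'e) chart = "'m set \<times> ('m \<Rightarrow> 'e)"

definition is_chart :: "('m::metric_space, 'e::euclidean_space) chart \<Rightarrow> bool" where
  "is_chart c \<longleftrightarrow> (case c of (U, \<phi>) \<Rightarrow>
     open U \<and> (open (\<phi> ` U) \<or> openin (top_of_set half_space) (\<phi> ` U)) \<and>
     homeomorphism U (\<phi> ` U) \<phi> (inv_into U \<phi>))"

definition transition :: "('m, 'e) chart \<Rightarrow> ('m, 'e) chart \<Rightarrow> 'e \<Rightarrow> 'e" where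
  "transition c c' = snd c' \<circ> inv_into (fst c) (snd c)"

definition smooth_atlas :: "('m::metric_space, 'e::euclidean_space) chart set \<Rightarrow> bool" where
  "smooth_atlas A \<longleftrightarrow> (\<forall>c\<in>A. is_chart c) \<and> (\<Union>c\<in>A. fst c) = UNIV \<and>
     (\<forall>c\<in>A. \<forall>c'\<in>A. smooth_on (snd c ` (fst c \<inter> fst c')) (transition c c'))"

text \<open>\<open>g c y\<close> is the coordinate expression of the metric in the chart \<open>c\<close> at the
  coordinate point \<open>y\<close>; the last clause is the transformation law.\<close>

definition riemannian_metric ::
  "('m::metric_space, 'e::euclidean_space) chart set \<Rightarrow>
   (('m, 'e) chart \<Rightarrow> 'e \<Rightarrow> 'e \<Rightarrow> 'e \<Rightarrow> real) \<Rightarrow> bool" where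
  "riemannian_metric A g \<longleftrightarrow>
     (\<forall>c\<in>A. \<forall>y\<in>snd c ` fst c.
        bilinear (g c y) \<and> (\<forall>v w. g c y v w = g c y w v) \<and> (\<forall>v. v \<noteq> 0 \<longrightarrow> 0 < g c y v v)) \<and>
     (\<forall>c\<in>A. \<forall>v w. smooth_on (snd c ` fst c) (\<lambda>y. g c y v w)) \<and>
     (\<forall>c\<in>A. \<forall>c'\<in>A. \<forall>x\<in>fst c \<inter> fst c'. \<forall>D v w.
        (transition c c' has_derivative D) (at (snd c x) within snd c ` (fst c \<inter> fst c')) \<longrightarrow>
        g c (snd c x) v w = g c' (snd c' x) (D v) (D w))"

definition piecewise_C1_curve ::
  "('m::metric_space, 'e::euclidean_space) chart set \<Rightarrow> (real \<Rightarrow> 'm) \<Rightarrow> bool" where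
  "piecewise_C1_curve A \<gamma> \<longleftrightarrow> path \<gamma> \<and>
     (\<forall>(U, \<phi>)\<in>A. \<forall>a b. 0 \<le> a \<and> a < b \<and> b \<le> 1 \<and> \<gamma> ` {a..b} \<subseteq> U \<longrightarrow>
        (\<phi> \<circ> \<gamma>) piecewise_C1_differentiable_on {a..b})"

text \<open>By the transformation law the choice of the chart does not matter.\<close>

definition riemannian_length ::
  "('m::metric_space, 'e::euclidean_space) chart set \<Rightarrow>
   (('m, 'e) chart \<Rightarrow> 'e \<Rightarrow> 'e \<Rightarrow> 'e \<Rightarrow> real) \<Rightarrow> (real \<Rightarrow> 'm) \<Rightarrow> ennreal" where
  "riemannian_length A g \<gamma> =
     (\<integral>\<^sup>+t\<in>{0..1}. (let c = (SOME c. c \<in> A \<and> \<gamma> t \<in> fst c);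
                           v = vector_derivative (snd c \<circ> \<gamma>) (at t)
                       in ennreal (sqrt (g c (snd c (\<gamma> t)) v v))) \<partial>lborel)"

text \<open>The distance of the type is the length distance, so the manifold is connected
  (the infimum over no curves is \<open>\<infinity>\<close>), and Hausdorff and second countable.
  The type of the coordinates has positive dimension; a connected manifold of dimension
  \<open>0\<close> is a point and is listed separately.\<close>

definition riemannian_manifold ::
  "nat \<Rightarrow> ('m::metric_space, 'e::euclidean_space) chart set \<Rightarrow>
   (('m, 'e) chart \<Rightarrow> 'e \<Rightarrow> 'e \<Rightarrow> 'e \<Rightarrow> real) \<Rightarrow> bool" where
  "riemannian_manifold n A g \<longleftrightarrow>
     (n = 0 \<and> (\<exists>x::'m. UNIV = {x})) \<or>
     (n = DIM('e) \<and> smooth_atlas A \<and> riemannian_metric A g \<and>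
      (\<forall>x y. ennreal (dist x y) =
         (INF \<gamma>\<in>{\<gamma>. piecewise_C1_curve A \<gamma> \<and> pathstart \<gamma> = x \<and> pathfinish \<gamma> = y}.
            riemannian_length A g \<gamma>)))"


section \<open>Currents in metric spaces (Ambrosio--Kirchheim)\<close>

text \<open>A functional on \<open>Lip\<^sub>b(X) \<times> Lip(X)\<^sup>k\<close> is a total function that vanishes outside
  this set, so that equality and addition of functionals are those of functions.\<close>

type_synonym 'a functional = "('a \<Rightarrow> real) \<Rightarrow> ('a \<Rightarrow> real) list \<Rightarrow> real"

definition lipschitz_fun :: "('a::metric_space \<Rightarrow> 'b::metric_space) \<Rightarrow> bool" where
  "lipschitz_fun h \<longleftrightarrow> (\<exists>L. L-lipschitz_on UNIV h)"

definition lip_const :: "('a::metric_space \<Rightarrow> 'b::metric_space) \<Rightarrow> real" where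
  "lip_const h = Inf {L. L-lipschitz_on UNIV h}"

definition metric_form :: "nat \<Rightarrow> ('a::metric_space \<Rightarrow> real) \<Rightarrow> ('a \<Rightarrow> real) list \<Rightarrow> bool" where
  "metric_form k f \<pi> \<longleftrightarrow>
     lipschitz_fun f \<and> bounded (range f) \<and> length \<pi> = k \<and> (\<forall>h\<in>set \<pi>. lipschitz_fun h)"

definition multilinear :: "nat \<Rightarrow> 'a::metric_space functional \<Rightarrow> bool" where
  "multilinear k T \<longleftrightarrow>
     (\<forall>f f' \<pi> a b. metric_form k f \<pi> \<and> metric_form k f' \<pi> \<longrightarrow>
        T (\<lambda>x. a * f x + b * f' x) \<pi> = a * T f \<pi> + b * T f' \<pi>) \<and>
     (\<forall>f \<pi> i h h' a b. metric_form k f \<pi> \<and> i < k \<and> lipschitz_fun h \<and> lipschitz_fun h' \<longrightarrow>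
        T f (\<pi>[i := (\<lambda>x. a * h x + b * h' x)]) = a * T f (\<pi>[i := h]) + b * T f (\<pi>[i := h']))"

definition weakly_continuous :: "nat \<Rightarrow> 'a::metric_space functional \<Rightarrow> bool" where
  "weakly_continuous k T \<longleftrightarrow>
     (\<forall>f \<pi> \<pi>s C. metric_form k f \<pi> \<and> (\<forall>j. metric_form k f (\<pi>s j)) \<and>
        (\<forall>j. \<forall>i<k. C-lipschitz_on UNIV (\<pi>s j ! i)) \<and>
        (\<forall>i<k. \<forall>x. (\<lambda>j. (\<pi>s j ! i) x) \<longlonglongrightarrow> (\<pi> ! i) x) \<longrightarrow>
        (\<lambda>j. T f (\<pi>s j)) \<longlonglongrightarrow> T f \<pi>)"

definition locality :: "nat \<Rightarrow> 'a::metric_space functional \<Rightarrow> bool" where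
  "locality k T \<longleftrightarrow>
     (\<forall>f \<pi>. metric_form k f \<pi> \<and>
        (\<exists>i<k. \<exists>U c. open U \<and> {x. f x \<noteq> 0} \<subseteq> U \<and> (\<forall>x\<in>U. (\<pi> ! i) x = c)) \<longrightarrow> T f \<pi> = 0)"

definition mass_bound :: "nat \<Rightarrow> 'a::metric_space functional \<Rightarrow> 'a measure \<Rightarrow> bool" where
  "mass_bound k T \<mu> \<longleftrightarrow> sets \<mu> = sets borel \<and> finite_measure \<mu> \<and>
     (\<forall>f \<pi>. metric_form k f \<pi> \<longrightarrow>
        \<bar>T f \<pi>\<bar> \<le> prod_list (map lip_const \<pi>) * (\<integral>x. \<bar>f x\<bar> \<partial>\<mu>))"

definition is_mass :: "nat \<Rightarrow> 'a::metric_space functional \<Rightarrow> 'a measure \<Rightarrow> bool" where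
  "is_mass k T \<mu> \<longleftrightarrow> mass_bound k T \<mu> \<and>
     (\<forall>\<nu>. mass_bound k T \<nu> \<longrightarrow> (\<forall>B\<in>sets borel. emeasure \<mu> B \<le> emeasure \<nu> B))"

text \<open>For a current of finite mass the minimal measure exists; the other case of the
  conditional is a default value.\<close>

definition mass :: "nat \<Rightarrow> 'a::metric_space functional \<Rightarrow> 'a measure" where
  "mass k T = (if \<exists>\<mu>. is_mass k T \<mu> then THE \<mu>. is_mass k T \<mu> else null_measure borel)"

definition currents :: "nat \<Rightarrow> 'a::metric_space functional set" where
  "currents k = {T. (\<forall>f \<pi>. \<not> metric_form k f \<pi> \<longrightarrow> T f \<pi> = 0) \<and>
     multilinear k T \<and> weakly_continuous k T \<and> locality k T \<and> (\<exists>\<mu>. mass_bound k T \<mu>)}"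

definition boundary :: "nat \<Rightarrow> 'a::metric_space functional \<Rightarrow> 'a functional" where
  "boundary k T = (\<lambda>f \<pi>. if 0 < k \<and> metric_form (k - 1) f \<pi> then T (\<lambda>_. 1) (f # \<pi>) else 0)"

definition pushforward ::
  "nat \<Rightarrow> ('a::metric_space \<Rightarrow> 'b::metric_space) \<Rightarrow> 'a functional \<Rightarrow> 'b functional" where
  "pushforward k \<phi> T =
     (\<lambda>f \<pi>. if metric_form k f \<pi> then T (f \<circ> \<phi>) (map (\<lambda>h. h \<circ> \<phi>) \<pi>) else 0)"

text \<open>The extension of \<open>T\<close> to bounded Borel functions \<open>h\<close> in the first argument, by density of
  the bounded Lipschitz functions in \<open>L\<^sup>1(\<parallel>T\<parallel>)\<close>.\<close>

definition borel_extension ::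
  "nat \<Rightarrow> 'a::metric_space functional \<Rightarrow> ('a \<Rightarrow> real) \<Rightarrow> ('a \<Rightarrow> real) list \<Rightarrow> real" where
  "borel_extension k T h \<pi> = (THE r. \<exists>F. (\<forall>j::nat. lipschitz_fun (F j) \<and> bounded (range (F j))) \<and>
     (\<lambda>j. \<integral>\<^sup>+x. ennreal \<bar>F j x - h x\<bar> \<partial>mass k T) \<longlonglongrightarrow> 0 \<and> (\<lambda>j. T (F j) \<pi>) \<longlonglongrightarrow> r)"

definition restriction :: "nat \<Rightarrow> 'a::metric_space functional \<Rightarrow> 'a set \<Rightarrow> 'a functional" where
  "restriction k T B =
     (\<lambda>f \<pi>. if metric_form k f \<pi> then borel_extension k T (\<lambda>x. indicator B x * f x) \<pi> else 0)"


subsection \<open>The spaces \<open>\<real>\<^sup>k\<close> with varying \<open>k\<close>\<close>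

text \<open>\<open>\<real>\<^sup>k\<close> is the set of functions supported on \<open>{..<k}\<close> in the sense of the library's
  extensional functions, with the Euclidean distance and the product Lebesgue measure.\<close>

definition Rk :: "nat \<Rightarrow> (nat \<Rightarrow> real) set" where
  "Rk k = ({..<k} \<rightarrow>\<^sub>E UNIV)"

definition Rk_dist :: "nat \<Rightarrow> (nat \<Rightarrow> real) \<Rightarrow> (nat \<Rightarrow> real) \<Rightarrow> real" where
  "Rk_dist k x y = L2_set (\<lambda>i. x i - y i) {..<k}"

definition Rk_lipschitz_on ::
  "nat \<Rightarrow> (nat \<Rightarrow> real) set \<Rightarrow> ((nat \<Rightarrow> real) \<Rightarrow> 'b::metric_space) \<Rightarrow> bool" where
  "Rk_lipschitz_on k B h \<longleftrightarrow> (\<exists>L. \<forall>x\<in>B. \<forall>y\<in>B. dist (h x) (h y) \<le> L * Rk_dist k x y)"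

definition Rk_form :: "nat \<Rightarrow> ((nat \<Rightarrow> real) \<Rightarrow> real) \<Rightarrow> ((nat \<Rightarrow> real) \<Rightarrow> real) list \<Rightarrow> bool" where
  "Rk_form k f \<pi> \<longleftrightarrow> Rk_lipschitz_on k (Rk k) f \<and> bounded (f ` Rk k) \<and>
     length \<pi> = k \<and> (\<forall>h\<in>set \<pi>. Rk_lipschitz_on k (Rk k) h)"

definition Rk_lebesgue :: "nat \<Rightarrow> (nat \<Rightarrow> real) measure" where
  "Rk_lebesgue k = (\<Pi>\<^sub>M i\<in>{..<k}. lborel)"

definition Rk_partial :: "nat \<Rightarrow> ((nat \<Rightarrow> real) \<Rightarrow> real) \<Rightarrow> (nat \<Rightarrow> real) \<Rightarrow> real" where
  "Rk_partial j h x = deriv (\<lambda>t. h (x(j := t))) (x j)"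

text \<open>The determinant of the matrix of partial derivatives (which exist almost everywhere), by
  the Leibniz formula because the size varies.\<close>

definition Rk_jacobian :: "nat \<Rightarrow> ((nat \<Rightarrow> real) \<Rightarrow> real) list \<Rightarrow> (nat \<Rightarrow> real) \<Rightarrow> real" where
  "Rk_jacobian k \<pi> x =
     (\<Sum>s | s permutes {..<k}. of_int (sign s) * (\<Prod>i<k. Rk_partial (s i) (\<pi> ! i) x))"

definition Rk_current ::
  "nat \<Rightarrow> ((nat \<Rightarrow> real) \<Rightarrow> int) \<Rightarrow> ((nat \<Rightarrow> real) \<Rightarrow> real) \<Rightarrow> ((nat \<Rightarrow> real) \<Rightarrow> real) list \<Rightarrow> real" where
  "Rk_current k \<theta> f \<pi> =
     (\<integral>x. of_int (\<theta> x) * f x * Rk_jacobian k \<pi> x \<partial>Rk_lebesgue k)"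


subsection \<open>Integral currents\<close>

definition countably_rectifiable :: "nat \<Rightarrow> 'a::metric_space set \<Rightarrow> bool" where
  "countably_rectifiable k S \<longleftrightarrow> S \<in> lambda_system UNIV UNIV (hausdorff_outer k) \<and>
     (\<exists>(B :: nat \<Rightarrow> (nat \<Rightarrow> real) set) F.
        (\<forall>j. B j \<subseteq> Rk k \<and> Rk_lipschitz_on k (B j) (F j)) \<and>
        hausdorff_outer k (S - (\<Union>j. F j ` B j)) = 0)"

definition rectifiable_current :: "nat \<Rightarrow> 'a::metric_space functional \<Rightarrow> bool" where
  "rectifiable_current k T \<longleftrightarrow> T \<in> currents k \<and>
     (\<exists>S. countably_rectifiable k S \<and> (AE x in mass k T. x \<in> S)) \<and>
     (\<forall>B\<in>sets borel. hausdorff_outer k B = 0 \<longrightarrow> emeasure (mass k T) B = 0)"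

text \<open>In degree \<open>0\<close> an integer rectifiable current is an integer combination of point
  evaluations.\<close>

definition integer_rectifiable :: "nat \<Rightarrow> 'a::metric_space functional \<Rightarrow> bool" where
  "integer_rectifiable k T \<longleftrightarrow>
     (if k = 0 then T \<in> currents 0 \<and>
        (\<exists>S (\<theta> :: 'a \<Rightarrow> int). countable S \<and> (\<lambda>x. \<bar>real_of_int (\<theta> x)\<bar>) summable_on S \<and>
           (\<forall>f. metric_form 0 f [] \<longrightarrow> T f [] = (\<Sum>\<^sub>\<infinity>x\<in>S. real_of_int (\<theta> x) * f x)))
      else rectifiable_current k T \<and>
        (\<forall>(\<phi> :: 'a \<Rightarrow> nat \<Rightarrow> real) A. (\<forall>i<k. lipschitz_fun (\<lambda>x. \<phi> x i)) \<and> range \<phi> \<subseteq> Rk k \<and> open A \<longrightarrow>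
           (\<exists>\<theta>. integrable (Rk_lebesgue k) (\<lambda>y. real_of_int (\<theta> y)) \<and>
              (\<forall>f \<pi>. Rk_form k f \<pi> \<longrightarrow>
                 restriction k T A (f \<circ> \<phi>) (map (\<lambda>h. h \<circ> \<phi>) \<pi>) = Rk_current k \<theta> f \<pi>))))"

definition normal_currents :: "nat \<Rightarrow> 'a::metric_space functional set" where
  "normal_currents k = {T \<in> currents k. 0 < k \<longrightarrow> boundary k T \<in> currents (k - 1)}"

definition integral_currents :: "nat \<Rightarrow> 'a::metric_space functional set" where
  "integral_currents k = {T \<in> normal_currents k. integer_rectifiable k T}"

definition compact_integral_currents :: "nat \<Rightarrow> 'a::metric_space functional set" where
  "compact_integral_currents k =
     {T \<in> integral_currents k. \<exists>K. compact K \<and> emeasure (mass k T) (- K) = 0}"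

text \<open>The degree \<open>k\<close> component of the reduced complex.\<close>

definition reduced_currents :: "('a::metric_space \<Rightarrow> ennreal) \<Rightarrow> nat \<Rightarrow> 'a functional set" where
  "reduced_currents \<rho>\<^sub>0 k = {T \<in> compact_integral_currents k.
     (\<integral>\<^sup>+x. epow (\<rho>\<^sub>0 x) k \<partial>mass k T) +
     (if k = 0 then 0 else (\<integral>\<^sup>+x. epow (\<rho>\<^sub>0 x) (k - 1) \<partial>mass (k - 1) (boundary k T))) < \<infinity>}"


section \<open>Injective Banach spaces\<close>

text \<open>Every Banach space is isometric to a closed subspace of \<open>l\<^sup>\<infinity>('i)\<close> for a suitable index
  type \<open>'i\<close>. Accordingly Banach spaces are closed subspaces of an ambient space of this form,
  and \<open>'i\<close> stays a type variable. Testing injectivity inside the ambient \<open>l\<^sup>\<infinity>('i)\<close>, which is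
  injective itself, yields the extension property with respect to all Banach spaces.\<close>

type_synonym 'i linf = "'i discrete \<Rightarrow>\<^sub>C real"

definition bounded_linear_into ::
  "'v::real_normed_vector set \<Rightarrow> 'v set \<Rightarrow> real \<Rightarrow> ('v \<Rightarrow> 'v) \<Rightarrow> bool" where
  "bounded_linear_into S V K L \<longleftrightarrow> L ` S \<subseteq> V \<and>
     (\<forall>x\<in>S. \<forall>y\<in>S. L (x + y) = L x + L y) \<and> (\<forall>x\<in>S. \<forall>c. L (c *\<^sub>R x) = c *\<^sub>R L x) \<and>
     (\<forall>x\<in>S. norm (L x) \<le> K * norm x)"

definition injective_banach :: "'i linf set \<Rightarrow> bool" where
  "injective_banach V \<longleftrightarrow> subspace V \<and> closed V \<and>
     (\<forall>W S L K. subspace W \<and> closed W \<and> subspace S \<and> S \<subseteq> W \<and> 0 \<le> K \<and> bounded_linear_into S V K L \<longrightarrow>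
        (\<exists>L'. bounded_linear_into W V K L' \<and> (\<forall>x\<in>S. L' x = L x)))"

definition isometric_embedding :: "('a::metric_space \<Rightarrow> 'b::metric_space) \<Rightarrow> 'b set \<Rightarrow> bool" where
  "isometric_embedding \<iota> V \<longleftrightarrow> range \<iota> \<subseteq> V \<and> (\<forall>x y. dist (\<iota> x) (\<iota> y) = dist x y)"


section \<open>Sobolev maps\<close>

definition curve_length :: "(real \<Rightarrow> 'a::metric_space) \<Rightarrow> real \<Rightarrow> real \<Rightarrow> ennreal" where
  "curve_length \<gamma> a b =
     (SUP ts\<in>{ts. sorted ts \<and> set ts \<subseteq> {a..b}}.
        ennreal (\<Sum>i<length ts - 1. dist (\<gamma> (ts ! i)) (\<gamma> (ts ! Suc i))))"

definition rectifiable_curve :: "(real \<Rightarrow> 'a::metric_space) \<Rightarrow> bool" where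
  "rectifiable_curve \<gamma> \<longleftrightarrow> path \<gamma> \<and> curve_length \<gamma> 0 1 < \<infinity>"

text \<open>Any two parameters with the same value of the length function give the same point.\<close>

definition arclength_param :: "(real \<Rightarrow> 'a::metric_space) \<Rightarrow> real \<Rightarrow> 'a" where
  "arclength_param \<gamma> s = \<gamma> (SOME t. t \<in> {0..1} \<and> curve_length \<gamma> 0 t = ennreal s)"

definition line_integral :: "('a::metric_space \<Rightarrow> ennreal) \<Rightarrow> (real \<Rightarrow> 'a) \<Rightarrow> ennreal" where
  "line_integral \<rho> \<gamma> =
     (\<integral>\<^sup>+s\<in>{0..enn2real (curve_length \<gamma> 0 1)}. \<rho> (arclength_param \<gamma> s) \<partial>lborel)"

definition modulus :: "'a::metric_space measure \<Rightarrow> real \<Rightarrow> (real \<Rightarrow> 'a) set \<Rightarrow> ennreal" where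
  "modulus \<mu> p \<Gamma> =
     (INF \<rho>\<in>{\<rho> \<in> borel_measurable borel. \<forall>\<gamma>\<in>\<Gamma>. rectifiable_curve \<gamma> \<longrightarrow> 1 \<le> line_integral \<rho> \<gamma>}.
        (\<integral>\<^sup>+x. epowr (\<rho> x) p \<partial>\<mu>))"

definition weak_upper_gradient ::
  "'a::metric_space measure \<Rightarrow> real \<Rightarrow> ('a \<Rightarrow> 'b::metric_space) \<Rightarrow> ('a \<Rightarrow> ennreal) \<Rightarrow> bool" where
  "weak_upper_gradient \<mu> p F \<rho> \<longleftrightarrow> \<rho> \<in> borel_measurable borel \<and>
     modulus \<mu> p {\<gamma>. rectifiable_curve \<gamma> \<and>
       \<not> ennreal (dist (F (pathstart \<gamma>)) (F (pathfinish \<gamma>))) \<le> line_integral \<rho> \<gamma>} = 0"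

definition minimal_weak_upper_gradient ::
  "'a::metric_space measure \<Rightarrow> real \<Rightarrow> ('a \<Rightarrow> 'b::metric_space) \<Rightarrow> ('a \<Rightarrow> ennreal) \<Rightarrow> bool" where
  "minimal_weak_upper_gradient \<mu> p F \<rho> \<longleftrightarrow>
     weak_upper_gradient \<mu> p F \<rho> \<and> Lq_loc \<mu> (ennreal p) \<rho> \<and>
     (\<forall>\<rho>'. weak_upper_gradient \<mu> p F \<rho>' \<and> Lq_loc \<mu> (ennreal p) \<rho>' \<longrightarrow> (AE x in \<mu>. \<rho> x \<le> \<rho>' x))"

text \<open>Sobolev maps are classes modulo equality almost everywhere: \<open>F\<close> is a representative of
  \<open>\<iota> \<circ> f\<close> in \<open>L\<^sup>p\<^sub>l\<^sub>o\<^sub>c(M, V)\<close> (strongly measurable) with a locally \<open>p\<close>-integrable weak upper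
  gradient.\<close>

definition sobolev_rep ::
  "'m::metric_space measure \<Rightarrow> real \<Rightarrow> ('n::metric_space \<Rightarrow> 'i linf) \<Rightarrow> 'i linf set \<Rightarrow>
   ('m \<Rightarrow> 'n) \<Rightarrow> ('m \<Rightarrow> 'i linf) \<Rightarrow> bool" where
  "sobolev_rep \<mu> p \<iota> V f F \<longleftrightarrow> range F \<subseteq> V \<and> (AE x in \<mu>. F x = \<iota> (f x)) \<and>
     F \<in> borel_measurable (completion \<mu>) \<and>
     (\<exists>D. countable D \<and> (AE x in \<mu>. F x \<in> closure D)) \<and>
     Lq_loc \<mu> (ennreal p) (\<lambda>x. ennreal (norm (F x))) \<and>
     (\<exists>\<rho>. weak_upper_gradient \<mu> p F \<rho> \<and> Lq_loc \<mu> (ennreal p) \<rho>)"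

definition sobolev_loc ::
  "'m::metric_space measure \<Rightarrow> real \<Rightarrow> ('n::metric_space \<Rightarrow> 'i linf) \<Rightarrow> 'i linf set \<Rightarrow> ('m \<Rightarrow> 'n) set" where
  "sobolev_loc \<mu> p \<iota> V = {f. \<exists>F. sobolev_rep \<mu> p \<iota> V f F}"

text \<open>\<open>\<rho>\<close> represents \<open>|df|\<close>.\<close>

definition represents_gradient ::
  "'m::metric_space measure \<Rightarrow> real \<Rightarrow> ('n::metric_space \<Rightarrow> 'i linf) \<Rightarrow> 'i linf set \<Rightarrow>
   ('m \<Rightarrow> 'n) \<Rightarrow> ('m \<Rightarrow> ennreal) \<Rightarrow> bool" where
  "represents_gradient \<mu> p \<iota> V f \<rho> \<longleftrightarrow>
     (\<exists>F \<rho>'. sobolev_rep \<mu> p \<iota> V f F \<and> minimal_weak_upper_gradient \<mu> p F \<rho>' \<and>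
        (AE x in \<mu>. \<rho> x = \<rho>' x))"


section \<open>Pushforward data\<close>

text \<open>\<open>fs k\<close> is the component of the chain morphism in degree \<open>k\<close>. In the last clause
  currents in a Banach space \<open>V'\<close> are tested on Lipschitz functions of the ambient space,
  which restrict to all Lipschitz functions of \<open>V'\<close>; the sum starts at index \<open>1\<close>.\<close>

definition chain_morphism ::
  "real \<Rightarrow> ('m::metric_space \<Rightarrow> ennreal) \<Rightarrow> (nat \<Rightarrow> 'm functional \<Rightarrow> 'n::metric_space functional) \<Rightarrow> bool" where
  "chain_morphism p \<rho>\<^sub>0 fs \<longleftrightarrow>
     (\<forall>k \<le> nat \<lfloor>p\<rfloor>.
        (\<forall>T\<in>reduced_currents \<rho>\<^sub>0 k. fs k T \<in> integral_currents k) \<and>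
        (\<forall>T\<in>reduced_currents \<rho>\<^sub>0 k. \<forall>S\<in>reduced_currents \<rho>\<^sub>0 k. fs k (T + S) = fs k T + fs k S) \<and>
        (0 < k \<longrightarrow> (\<forall>T\<in>reduced_currents \<rho>\<^sub>0 k. fs (k - 1) (boundary k T) = boundary k (fs k T))))"

definition pushforward_data ::
  "'m::metric_space measure \<Rightarrow> real \<Rightarrow> ('n::metric_space \<Rightarrow> 'i linf) \<Rightarrow> 'i linf set \<Rightarrow> ('m \<Rightarrow> 'n) \<Rightarrow>
   ('m \<Rightarrow> 'n) \<Rightarrow> ('m \<Rightarrow> ennreal) \<Rightarrow> ('m \<Rightarrow> ennreal) \<Rightarrow>
   (nat \<Rightarrow> 'm functional \<Rightarrow> 'n functional) \<Rightarrow> bool" where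
  "pushforward_data \<mu> p \<iota> V f fh \<rho>h \<rho>\<^sub>0 fs \<longleftrightarrow>
     fh \<in> borel_measurable borel \<and> (AE x in \<mu>. fh x = f x) \<and>
     \<rho>h \<in> borel_measurable borel \<and> represents_gradient \<mu> p \<iota> V f \<rho>h \<and>
     \<rho>\<^sub>0 \<in> borel_measurable borel \<and> \<rho>\<^sub>0 \<in> Lp_plus \<mu> p \<and>
     chain_morphism p \<rho>\<^sub>0 fs \<and>
     (\<forall>k \<le> nat \<lfloor>p\<rfloor>. \<forall>T\<in>reduced_currents \<rho>\<^sub>0 k. \<forall>E\<in>sets borel.
        emeasure (mass k (fs k T)) E \<le> (\<integral>\<^sup>+x\<in>fh -` E. epow (\<rho>h x) k \<partial>mass k T) \<and>
        (\<integral>\<^sup>+x\<in>fh -` E. epow (\<rho>h x) k \<partial>mass k T) < \<infinity>) \<and>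
     (\<forall>(V' :: 'i linf set) \<iota>'. injective_banach V' \<and> isometric_embedding \<iota>' V' \<longrightarrow>
        (\<exists>(E :: nat \<Rightarrow> 'm set) (F :: nat \<Rightarrow> 'm \<Rightarrow> 'i linf).
           (\<forall>i. E i \<in> sets borel) \<and> disjoint_family E \<and> (\<Union>i. E i) = UNIV \<and>
           E 0 \<in> null_sets \<mu> \<and> {x. \<rho>\<^sub>0 x = \<infinity>} \<subseteq> E 0 \<and>
           (\<forall>i\<ge>1. lipschitz_fun (F i) \<and> range (F i) \<subseteq> V' \<and> (\<forall>x\<in>E i. F i x = \<iota>' (fh x))) \<and>
           (\<forall>k \<le> nat \<lfloor>p\<rfloor>. \<forall>T\<in>reduced_currents \<rho>\<^sub>0 k. \<forall>g \<pi>. metric_form k g \<pi> \<longrightarrow>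
              (\<lambda>i. pushforward k (F (Suc i)) (restriction k T (E (Suc i))) g \<pi>)
                sums pushforward k \<iota>' (fs k T) g \<pi>)))"


section \<open>Cochains\<close>

definition subadditive_cochain :: "'a functional set \<Rightarrow> ('a functional \<Rightarrow> ereal) \<Rightarrow> bool" where
  "subadditive_cochain C \<Omega> \<longleftrightarrow> \<Omega> 0 = 0 \<and> (\<forall>T\<in>C. \<forall>S\<in>C. \<bar>\<Omega> T\<bar> \<le> \<bar>\<Omega> (T + S)\<bar> + \<bar>\<Omega> S\<bar>)"

definition additive_cochain :: "'a functional set \<Rightarrow> ('a functional \<Rightarrow> ereal) \<Rightarrow> bool" where
  "additive_cochain C \<Omega> \<longleftrightarrow> subadditive_cochain C \<Omega> \<and>
     (\<forall>T\<in>C. \<forall>S\<in>C. \<bar>\<Omega> (T + S)\<bar> \<noteq> \<infinity> \<and> \<bar>\<Omega> T\<bar> \<noteq> \<infinity> \<and> \<bar>\<Omega> S\<bar> \<noteq> \<infinity> \<longrightarrow> \<Omega> (T + S) = \<Omega> T + \<Omega> S)"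

definition finite_cochain :: "'a functional set \<Rightarrow> ('a functional \<Rightarrow> ereal) \<Rightarrow> bool" where
  "finite_cochain C \<Omega> \<longleftrightarrow> (\<forall>T\<in>C. \<bar>\<Omega> T\<bar> \<noteq> \<infinity>)"

definition upper_norm ::
  "nat \<Rightarrow> 'a::metric_space functional set \<Rightarrow> ('a functional \<Rightarrow> ereal) \<Rightarrow> ('a \<Rightarrow> ennreal) \<Rightarrow> bool" where
  "upper_norm k C \<Omega> \<rho> \<longleftrightarrow> \<rho> \<in> borel_measurable borel \<and>
     (\<forall>T\<in>C. \<bar>\<Omega> T\<bar> \<le> enn2ereal (\<integral>\<^sup>+x. \<rho> x \<partial>mass k T))"

definition bounded_density :: "('a \<Rightarrow> ennreal) \<Rightarrow> bool" where
  "bounded_density \<rho> \<longleftrightarrow> (\<exists>C<\<infinity>. \<forall>x. \<rho> x \<le> C)"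

definition Linf_cochains ::
  "nat \<Rightarrow> 'a::metric_space functional set \<Rightarrow> ('a functional \<Rightarrow> ereal) set" where
  "Linf_cochains k C =
     {\<Omega>. subadditive_cochain C \<Omega> \<and> (\<exists>\<rho>. upper_norm k C \<Omega> \<rho> \<and> bounded_density \<rho>)}"

definition pullback_cochain ::
  "('m functional \<Rightarrow> 'n functional) \<Rightarrow> ('n functional \<Rightarrow> ereal) \<Rightarrow> 'm functional \<Rightarrow> ereal" where
  "pullback_cochain F \<Omega> T = \<Omega> (F T)"

end

theory Submission
  imports Defs
begin

text \<open>
  The mass bound for the chain morphism says that \<open>\<parallel>f\<^sub>\<star>T\<parallel>\<close> is dominated by the image under \<open>f\<close> of
  the measure with density \<open>|df|\<^sup>k\<close> relative to \<open>\<parallel>T\<parallel>\<close>; integrating \<open>\<rho>\<close> against both measures gives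
  the upper norm of the pullback, and boundedness of \<open>\<rho>\<close> with the finiteness of the mass of
  \<open>f\<^sub>\<star>T\<close> gives finite values. The algebraic properties are inherited because \<open>f\<^sub>\<star>\<close> is additive.
  In degree \<open>0\<close> the local bound on the upper norm uses that \<open>|df|\<close>, being locally
  \<open>p\<close>-integrable, is finite almost everywhere, since \<open>\<infinity>\<^sup>0 = \<infinity>\<close>.
\<close>

section \<open>The mass measure\<close>

text \<open>Two minimal measures dominate each other on every Borel set. This justifies the definite
  description in \<open>mass\<close>.\<close>

lemma is_mass_unique:
  assumes "is_mass k T \<mu>" "is_mass k T \<nu>"
  shows "\<mu> = \<nu>"
proof (rule measure_eqI)
  show "sets \<mu> = sets \<nu>"
    using assms by (auto simp: is_mass_def mass_bound_def)
  fix A assume "A \<in> sets \<mu>"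
  with assms show "emeasure \<mu> A = emeasure \<nu> A"
    by (intro antisym) (auto simp: is_mass_def mass_bound_def)
qed

lemma mass_eqI: "is_mass k T \<mu> \<Longrightarrow> mass k T = \<mu>"
  unfolding mass_def using is_mass_unique by (metis (no_types, lifting) the_equality)

text \<open>Where no minimal measure exists, \<open>mass\<close> falls back to the null measure on
  \<open>borel\<close>, so the claim holds for every functional \<open>T\<close>.\<close>

lemma sets_mass [measurable_cong, simp]: "sets (mass k T) = sets borel"
proof (cases "\<exists>\<mu>. is_mass k T \<mu>")
  case True
  then obtain \<mu> where "is_mass k T \<mu>" ..
  then show ?thesis
    using mass_eqI[of k T \<mu>] by (simp add: is_mass_def mass_bound_def)
qed (simp add: mass_def)

lemma space_mass [simp]: "space (mass k T) = UNIV"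
  by (simp add: sets_eq_imp_space_eq[of _ borel])

section \<open>The zero current\<close>

lemma mass_bound_0: "mass_bound k 0 (null_measure borel)"
  by (auto simp: mass_bound_def intro!: finite_measureI)

lemma mass_0: "mass k 0 = null_measure borel"
  by (rule mass_eqI) (simp add: is_mass_def mass_bound_0)

lemma zero_in_currents: "0 \<in> currents k"
  unfolding currents_def multilinear_def weakly_continuous_def locality_def
  using mass_bound_0 by auto

lemma boundary_0: "boundary k 0 = 0"
  by (simp add: boundary_def fun_eq_iff)

lemma restriction_0: "restriction k 0 B = 0"
proof -
  have "borel_extension k 0 h \<pi> = 0" for h and \<pi> :: "('a \<Rightarrow> real) list"
    unfolding borel_extension_def
  proof (rule the_equality)
    show "\<exists>F. (\<forall>j::nat. lipschitz_fun (F j) \<and> bounded (range (F j))) \<and>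
        (\<lambda>j. \<integral>\<^sup>+x. ennreal \<bar>F j x - h x\<bar> \<partial>mass k 0) \<longlonglongrightarrow> 0 \<and> (\<lambda>j. (0 :: 'a functional) (F j) \<pi>) \<longlonglongrightarrow> 0"
      \<comment> \<open>Since the mass of the zero current is the null measure, the constant
        sequence 0 approximates every \<open>h\<close>, measurable or not.\<close>
      by (rule exI[of _ "\<lambda>_ _. 0"])
        (auto simp: mass_0 lipschitz_fun_def intro!: exI[of _ 0] lipschitz_onI)
  qed (auto dest: LIMSEQ_unique)
  then show ?thesis
    by (simp add: restriction_def fun_eq_iff)
qed

lemma hausdorff_outer_empty: "hausdorff_outer k {} = 0"
proof -
  have "(INF C\<in>{C :: nat \<Rightarrow> 'a set. {} \<subseteq> (\<Union>i. C i) \<and> (\<forall>i. bounded (C i) \<and> diameter (C i) \<le> \<delta>)}.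
      (\<Sum>i. hausdorff_gauge k (C i))) = 0" if "0 < \<delta>" for \<delta>
    using that
    by (intro antisym INF_lower2[of "\<lambda>_. {}"]) (auto simp: hausdorff_gauge_def diameter_def)
  then show ?thesis
    by (simp add: hausdorff_outer_def)
qed

lemma countably_rectifiable_empty: "countably_rectifiable k {}"
  by (auto simp: countably_rectifiable_def lambda_system_def hausdorff_outer_empty
      Rk_lipschitz_on_def intro!: exI[of _ "\<lambda>_. {}"])

lemma integer_rectifiable_0: "integer_rectifiable k 0"
proof (cases "k = 0")
  case True
  then show ?thesis
    by (auto simp: integer_rectifiable_def zero_in_currents intro!: exI[of _ "{}"])
next
  case False
  \<comment> \<open>The whole space is null here, so the empty set carries the mass and serves as
    the rectifiable set.\<close>
  have "AE x in null_measure borel. x \<in> {}"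
    by (rule AE_I[of _ _ UNIV]) auto
  then have "\<exists>S :: 'a set. countably_rectifiable k S \<and> (AE x in null_measure borel. x \<in> S)"
    using countably_rectifiable_empty by blast
  then have "rectifiable_current k (0 :: 'a functional)"
    unfolding rectifiable_current_def mass_0 by (simp add: zero_in_currents)
  with False show ?thesis
    by (auto simp: integer_rectifiable_def restriction_0 Rk_current_def intro!: exI[of _ "\<lambda>_. 0"])
qed

text \<open>Additivity of \<open>fs k\<close> is available on this set only; with 0 in it,
  \<open>fs k 0 = 0\<close> follows, as the normalization of the pulled back cochain at 0
  requires.\<close>

lemma zero_in_reduced_currents: "0 \<in> reduced_currents \<rho>\<^sub>0 k"
  by (auto simp: reduced_currents_def compact_integral_currents_def integral_currents_def
      normal_currents_def zero_in_currents boundary_0 integer_rectifiable_0 mass_0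
      intro!: exI[of _ "{}"])

section \<open>The conventions on powers\<close>

lemma borel_measurable_epow [measurable]:
  assumes [measurable]: "f \<in> borel_measurable M"
  shows "(\<lambda>x. epow (f x) k) \<in> borel_measurable M"
  unfolding epow_def by measurable

lemma epow_0_le_1: "x < \<infinity> \<Longrightarrow> epow x 0 \<le> 1"
  by (auto simp: epow_def)

text \<open>Raising \<open>a * x ^ k \<le> C * x ^ k\<close> to the power \<open>p / k\<close> turns
  \<open>x ^ k\<close> into the \<open>p\<close>-th power of \<open>x\<close>, which is where the
  exponent \<open>p / k\<close> comes from.\<close>

lemma epowr_mult_power_le:
  assumes "a \<le> C" "0 < C" "C < \<infinity>" "0 < k" "0 < p"
  shows "epowr (a * x ^ k) (p / real k) \<le> ennreal (enn2real C powr (p / real k)) * epowr x p"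
proof (cases "x = \<infinity>")
  case True
  \<comment> \<open>A positive factor keeps the right-hand side infinite when
    \<open>x = \<infinity>\<close>.\<close>
  have "enn2real C powr (p / real k) > 0"
    using assms by (auto simp: enn2real_eq_0_iff)
  then show ?thesis
    using True by (simp add: epowr_def ennreal_mult_top)
next
  case False
  then obtain r where r: "x = ennreal r" "0 \<le> r"
    by (cases x) auto
  obtain c where c: "C = ennreal c" "0 \<le> c"
    using assms by (cases C) auto
  obtain b where b: "a = ennreal b" "0 \<le> b"
    using assms by (cases a) (auto simp: top_unique)
  have "b \<le> c"
    using assms b c by simp
  have eq: "a * x ^ k = ennreal (b * r ^ k)"
    using r b by (simp add: ennreal_mult ennreal_power)
  \<comment> \<open>The case \<open>r = 0\<close> is separate because rewriting \<open>^\<close> as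
    \<open>powr\<close> requires a positive base.\<close>
  have "(r ^ k) powr (p / real k) = r powr p"
    using assms r by (cases "r = 0") (simp_all add: powr_powr flip: powr_realpow)
  then have "(b * r ^ k) powr (p / real k) = b powr (p / real k) * r powr p"
    using r b by (simp add: powr_mult)
  also have "\<dots> \<le> c powr (p / real k) * r powr p"
    using assms b \<open>b \<le> c\<close> by (intro mult_right_mono powr_mono2) auto
  finally show ?thesis
    unfolding eq using r b c by (simp add: epowr_def flip: ennreal_mult)
qed

section \<open>Local integrability\<close>

text \<open>The sigma-algebra of \<open>measure_of\<close> depends on the generating sets alone,
  whether or not the outer measure is countably additive on them.\<close>

lemma sets_hausdorff_measure: "sets (hausdorff_measure n) = sets borel"
  unfolding hausdorff_measure_def using sets.sigma_sets_eq[of borel] by simp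

text \<open>Changing \<open>h\<close> on a null set alters neither local integrals nor essential
  bounds. It transfers integrability from the minimal weak upper gradient to its Borel
  representative.\<close>

lemma Lq_loc_AE_cong:
  assumes "Lq_loc \<mu> q h" "h' \<in> borel_measurable (completion \<mu>)" "AE x in \<mu>. h' x = h x"
  shows "Lq_loc \<mu> q h'"
  unfolding Lq_loc_def
proof (intro conjI allI)
  fix x
  obtain U where U: "open U" "x \<in> U"
    "if q = \<infinity> then \<exists>C<\<infinity>. AE y in \<mu>. y \<in> U \<longrightarrow> h y \<le> C
     else (\<integral>\<^sup>+y\<in>U. epowr (h y) (enn2real q) \<partial>completion \<mu>) < \<infinity>"
    using assms(1) unfolding Lq_loc_def by blast
  have "(\<integral>\<^sup>+y\<in>U. epowr (h' y) (enn2real q) \<partial>completion \<mu>) =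
      (\<integral>\<^sup>+y\<in>U. epowr (h y) (enn2real q) \<partial>completion \<mu>)"
    using assms(3) by (intro nn_integral_cong_AE) (auto elim: eventually_mono dest: AE_completion)
  moreover have "AE y in \<mu>. y \<in> U \<longrightarrow> h' y \<le> C" if "AE y in \<mu>. y \<in> U \<longrightarrow> h y \<le> C" for C
    using that assms(3) by eventually_elim simp
  ultimately show "\<exists>U. open U \<and> x \<in> U \<and>
      (if q = \<infinity> then \<exists>C<\<infinity>. AE y in \<mu>. y \<in> U \<longrightarrow> h' y \<le> C
       else (\<integral>\<^sup>+y\<in>U. epowr (h' y) (enn2real q) \<partial>completion \<mu>) < \<infinity>)"
    using U by (intro exI[of _ U]) (auto split: if_splits)
qed (fact assms(2))

lemma borel_measurable_epowr [measurable]: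
  assumes [measurable]: "f \<in> borel_measurable M"
  shows "(\<lambda>x. epowr (f x) q) \<in> borel_measurable M"
  unfolding epowr_def by measurable

lemma Lq_loc_mult_epow:
  assumes sets_\<mu>: "sets \<mu> = sets borel"
    and \<sigma>: "\<sigma> \<in> borel_measurable borel" "bounded_density \<sigma>"
    and h: "h \<in> borel_measurable borel" "Lq_loc \<mu> (ennreal p) h" and "1 \<le> p"
  shows "Lq_loc \<mu> (ennreal p / of_nat k) (\<lambda>x. \<sigma> x * epow (h x) k)"
  unfolding Lq_loc_def
proof (intro conjI allI)
  have [measurable]: "\<sigma> \<in> borel_measurable \<mu>" "h \<in> borel_measurable \<mu>"
    using \<sigma> h by (simp_all add: measurable_cong_sets[OF sets_\<mu> refl])
  have [measurable]: "h \<in> borel_measurable (completion \<mu>)"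
    by (simp add: measurable_completion)
  show "(\<lambda>x. \<sigma> x * epow (h x) k) \<in> borel_measurable (completion \<mu>)"
    by (rule measurable_completion) measurable
  obtain C where C: "0 < C" "C < \<infinity>" "\<And>x. \<sigma> x \<le> C"
  proof -
    obtain D where "D < \<infinity>" "\<And>x. \<sigma> x \<le> D"
      using \<sigma>(2) unfolding bounded_density_def by blast
    then show thesis
      \<comment> \<open>Adding 1 makes the bound strictly positive, as
        \<open>epowr_mult_power_le\<close> demands.\<close>
      by (intro that[of "D + 1"]) (auto simp: zero_less_iff_neq_zero intro: add_increasing2)
  qed
  fix x
  obtain U where U: "open U" "x \<in> U" "(\<integral>\<^sup>+y\<in>U. epowr (h y) p \<partial>completion \<mu>) < \<infinity>"
    using h(2) \<open>1 \<le> p\<close> unfolding Lq_loc_def by auto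
  have [measurable]: "U \<in> sets (completion \<mu>)"
    using U(1) sets_\<mu> by (simp add: sets_completionI_sets)
  show "\<exists>U. open U \<and> x \<in> U \<and>
      (if ennreal p / of_nat k = \<infinity> then \<exists>C<\<infinity>. AE y in \<mu>. y \<in> U \<longrightarrow> \<sigma> y * epow (h y) k \<le> C
       else (\<integral>\<^sup>+y\<in>U. epowr (\<sigma> y * epow (h y) k) (enn2real (ennreal p / of_nat k)) \<partial>completion \<mu>) < \<infinity>)"
  proof (cases "k = 0")
    case True
    \<comment> \<open>A finite integral forces a finite integrand almost everywhere. As
      \<open>epowr\<close> maps \<open>\<infinity>\<close> to \<open>\<infinity>\<close>,
      \<open>h\<close> is finite almost everywhere on \<open>U\<close>, and there
      \<open>epow (h y) 0 \<le> 1\<close>.\<close>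
    have "AE y in completion \<mu>. epowr (h y) p * indicator U y \<noteq> \<infinity>"
      using U(3) by (intro nn_integral_PInf_AE) auto
    then have "AE y in \<mu>. epowr (h y) p * indicator U y \<noteq> \<infinity>"
      by (simp add: AE_completion_iff)
    then have "AE y in \<mu>. y \<in> U \<longrightarrow> \<sigma> y * epow (h y) k \<le> C"
    proof eventually_elim
      case (elim y)
      show ?case
      proof
        assume "y \<in> U"
        with elim have "h y < \<infinity>"
          by (auto simp: epowr_def less_top[symmetric])
        then show "\<sigma> y * epow (h y) k \<le> C"
          using mult_mono[OF C(3) epow_0_le_1] True by fastforce
      qed
    qed
    \<comment> \<open>Dividing a positive extended real by 0 gives \<open>\<infinity>\<close>, which
      selects the branch of essential bounds.\<close>
    moreover have "ennreal p / of_nat k = \<infinity>"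
      using True \<open>1 \<le> p\<close> by simp
    ultimately show ?thesis
      using U C(2) by auto
  next
    case False
    have q: "ennreal p / of_nat k = ennreal (p / real k)"
      using False \<open>1 \<le> p\<close> by (simp add: ennreal_of_nat_eq_real_of_nat divide_ennreal)
    let ?c = "ennreal (enn2real C powr (p / real k))"
    have "(\<integral>\<^sup>+y\<in>U. epowr (\<sigma> y * epow (h y) k) (p / real k) \<partial>completion \<mu>)
        \<le> (\<integral>\<^sup>+y. ?c * (epowr (h y) p * indicator U y) \<partial>completion \<mu>)"
      using False \<open>1 \<le> p\<close> epowr_mult_power_le[OF C(3,1,2)]
      by (intro nn_integral_mono) (auto simp: epow_def split: split_indicator)
    also have "\<dots> = ?c * (\<integral>\<^sup>+y\<in>U. epowr (h y) p \<partial>completion \<mu>)"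
      by (rule nn_integral_cmult) measurable
    also have "\<dots> < \<infinity>"
      using U(3) by (simp add: ennreal_mult_less_top)
    finally show ?thesis
      using U \<open>1 \<le> p\<close> by (auto simp: q)
  qed
qed

section \<open>Pullback of cochains\<close>

text \<open>The last hypothesis says setwise that \<open>N\<close> lies below the image under
  \<open>\<phi>\<close> of the measure with density \<open>w\<close>. Integrals are monotone in the
  measure, and a change of variables finishes.\<close>

lemma nn_integral_le_pullback:
  assumes [measurable_cong]: "sets M = sets borel" "sets N = sets borel"
    and [measurable]: "\<phi> \<in> borel_measurable borel" "w \<in> borel_measurable borel"
      "\<rho> \<in> borel_measurable borel"
    and le: "\<And>E. E \<in> sets borel \<Longrightarrow> emeasure N E \<le> (\<integral>\<^sup>+x\<in>\<phi> -` E. w x \<partial>M)"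
  shows "(\<integral>\<^sup>+y. \<rho> y \<partial>N) \<le> (\<integral>\<^sup>+x. \<rho> (\<phi> x) * w x \<partial>M)"
proof -
  let ?D = "distr (density M w) borel \<phi>"
  have space_M: "space M = UNIV"
    using assms(1) by (simp add: sets_eq_imp_space_eq[of _ borel])
  have "emeasure N E \<le> emeasure ?D E" if [measurable]: "E \<in> sets borel" for E
  proof -
    have [measurable]: "\<phi> -` E \<in> sets M"
      using measurable_sets[of \<phi> borel borel E] assms(1) by simp
    show ?thesis
      using le[OF that] by (simp add: emeasure_distr emeasure_density space_M)
  qed
  \<comment> \<open>The order on measures compares spaces and sigma-algebras first; as these agree,
    it reduces to the setwise comparison.\<close>
  then have "N \<le> ?D"
    using assms(2) by (auto simp: le_measure)
  then have "(\<integral>\<^sup>+y. \<rho> y \<partial>N) \<le> (\<integral>\<^sup>+y. \<rho> y \<partial>?D)"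
    using assms(2) by (intro nn_integral_mono_measure) auto
  also have "\<dots> = (\<integral>\<^sup>+x. \<rho> (\<phi> x) * w x \<partial>M)"
    by (simp add: nn_integral_distr nn_integral_density mult.commute)
  finally show ?thesis .
qed

lemma subadditive_pullback_cochain:
  assumes "subadditive_cochain C' \<Omega>" "\<And>T. T \<in> C \<Longrightarrow> F T \<in> C'"
    and "\<And>T S. T \<in> C \<Longrightarrow> S \<in> C \<Longrightarrow> F (T + S) = F T + F S" "0 \<in> C"
  shows "subadditive_cochain C (pullback_cochain F \<Omega>)"
proof -
  \<comment> \<open>Functionals are real-valued, so \<open>F 0\<close> cancels pointwise.\<close>
  have "F 0 = F 0 + F 0"
    using assms(3)[of 0 0] assms(4) by simp
  then have "F 0 = 0"
    by (simp add: fun_eq_iff)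
  then show ?thesis
    using assms by (auto simp: subadditive_cochain_def pullback_cochain_def)
qed

lemma additive_pullback_cochain:
  assumes "additive_cochain C' \<Omega>" "\<And>T. T \<in> C \<Longrightarrow> F T \<in> C'"
    and "\<And>T S. T \<in> C \<Longrightarrow> S \<in> C \<Longrightarrow> F (T + S) = F T + F S" "0 \<in> C"
  shows "additive_cochain C (pullback_cochain F \<Omega>)"
  using assms subadditive_pullback_cochain[of C' \<Omega> C F]
  by (simp add: additive_cochain_def pullback_cochain_def)

theorem corollary1p2:
  fixes atlas :: "('m::metric_space, 'e::euclidean_space) chart set"
    and g :: "('m, 'e) chart \<Rightarrow> 'e \<Rightarrow> 'e \<Rightarrow> 'e \<Rightarrow> real"
    and \<mu> :: "'m measure"
    and f fh :: "'m \<Rightarrow> 'n::complete_space"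
    and \<rho>h \<rho>\<^sub>0 :: "'m \<Rightarrow> ennreal"
    and fs :: "nat \<Rightarrow> 'm functional \<Rightarrow> 'n functional"
    and \<iota> :: "'n \<Rightarrow> 'i linf"
    and V :: "'i linf set"
    and \<Omega> :: "'n functional \<Rightarrow> ereal"
    and \<rho> :: "'n \<Rightarrow> ennreal"
    and p :: real and k n :: nat
  assumes "ulam_card (UNIV :: 'm set)" "ulam_card (UNIV :: 'n set)" "ulam_card (UNIV :: 'i linf set)"
    and "riemannian_manifold n atlas g"
    and "\<mu> = hausdorff_measure n"
    and "1 \<le> p"
    and "injective_banach V" "isometric_embedding \<iota> V"
    and "f \<in> sobolev_loc \<mu> p \<iota> V"
    and "pushforward_data \<mu> p \<iota> V f fh \<rho>h \<rho>\<^sub>0 fs"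
    and "k \<le> nat \<lfloor>p\<rfloor>"
    and "\<Omega> \<in> Linf_cochains k (integral_currents k)"
    and "upper_norm k (integral_currents k) \<Omega> \<rho>" "bounded_density \<rho>"
  shows "subadditive_cochain (reduced_currents \<rho>\<^sub>0 k) (pullback_cochain (fs k) \<Omega>) \<and>
    finite_cochain (reduced_currents \<rho>\<^sub>0 k) (pullback_cochain (fs k) \<Omega>) \<and>
    upper_norm k (reduced_currents \<rho>\<^sub>0 k) (pullback_cochain (fs k) \<Omega>)
      (\<lambda>x. \<rho> (fh x) * epow (\<rho>h x) k) \<and>
    Lq_loc \<mu> (ennreal p / of_nat k) (\<lambda>x. \<rho> (fh x) * epow (\<rho>h x) k) \<and>
    (additive_cochain (integral_currents k) \<Omega> \<longrightarrow>
      additive_cochain (reduced_currents \<rho>\<^sub>0 k) (pullback_cochain (fs k) \<Omega>))"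
proof -
  have sets_\<mu>: "sets \<mu> = sets borel"
    using assms(5) by (simp add: sets_hausdorff_measure)
  have [measurable]: "fh \<in> borel_measurable borel"
    and \<rho>h [measurable]: "\<rho>h \<in> borel_measurable borel"
    and grad: "represents_gradient \<mu> p \<iota> V f \<rho>h"
    and chain: "chain_morphism p \<rho>\<^sub>0 fs"
    and bound: "\<And>T E. T \<in> reduced_currents \<rho>\<^sub>0 k \<Longrightarrow> E \<in> sets borel \<Longrightarrow>
      emeasure (mass k (fs k T)) E \<le> (\<integral>\<^sup>+x\<in>fh -` E. epow (\<rho>h x) k \<partial>mass k T) \<and>
      (\<integral>\<^sup>+x\<in>fh -` E. epow (\<rho>h x) k \<partial>mass k T) < \<infinity>"
    using assms(10) \<open>k \<le> nat \<lfloor>p\<rfloor>\<close> unfolding pushforward_data_def by blast+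
  have into: "\<And>T. T \<in> reduced_currents \<rho>\<^sub>0 k \<Longrightarrow> fs k T \<in> integral_currents k"
    and add: "\<And>T S. T \<in> reduced_currents \<rho>\<^sub>0 k \<Longrightarrow> S \<in> reduced_currents \<rho>\<^sub>0 k \<Longrightarrow>
      fs k (T + S) = fs k T + fs k S"
    using chain \<open>k \<le> nat \<lfloor>p\<rfloor>\<close> unfolding chain_morphism_def by blast+
  have [measurable]: "\<rho> \<in> borel_measurable borel"
    and \<Omega>_le: "\<And>T. T \<in> integral_currents k \<Longrightarrow> \<bar>\<Omega> T\<bar> \<le> enn2ereal (\<integral>\<^sup>+x. \<rho> x \<partial>mass k T)"
    using assms(13) unfolding upper_norm_def by blast+
  obtain C where C: "C < \<infinity>" "\<And>x. \<rho> x \<le> C"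
    using assms(14) unfolding bounded_density_def by blast

  have "subadditive_cochain (integral_currents k) \<Omega>"
    using assms(12) by (simp add: Linf_cochains_def)
  then have "subadditive_cochain (reduced_currents \<rho>\<^sub>0 k) (pullback_cochain (fs k) \<Omega>)"
    using into add zero_in_reduced_currents by (rule subadditive_pullback_cochain)
  moreover have "finite_cochain (reduced_currents \<rho>\<^sub>0 k) (pullback_cochain (fs k) \<Omega>)"
    unfolding finite_cochain_def pullback_cochain_def
  proof
    fix T assume T: "T \<in> reduced_currents \<rho>\<^sub>0 k"
    have "(\<integral>\<^sup>+x. \<rho> x \<partial>mass k (fs k T)) \<le> (\<integral>\<^sup>+x. C \<partial>mass k (fs k T))"
      by (intro nn_integral_mono C)
    also have "\<dots> = C * emeasure (mass k (fs k T)) UNIV"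
      by simp
    \<comment> \<open>The choice \<open>E = UNIV\<close> in the mass bound shows that
      \<open>fs k T\<close> has finite mass.\<close>
    also have "\<dots> < \<infinity>"
      using bound[OF T, of UNIV] C(1) by (auto simp: ennreal_mult_less_top intro: le_less_trans)
    finally have "enn2ereal (\<integral>\<^sup>+x. \<rho> x \<partial>mass k (fs k T)) < \<infinity>"
      by (simp add: less_ennreal.rep_eq)
    then show "\<bar>\<Omega> (fs k T)\<bar> \<noteq> \<infinity>"
      using \<Omega>_le[OF into[OF T]] by auto
  qed
  moreover have "upper_norm k (reduced_currents \<rho>\<^sub>0 k) (pullback_cochain (fs k) \<Omega>)
      (\<lambda>x. \<rho> (fh x) * epow (\<rho>h x) k)"
    unfolding upper_norm_def pullback_cochain_def
  proof (intro conjI ballI)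
    fix T assume T: "T \<in> reduced_currents \<rho>\<^sub>0 k"
    have "(\<integral>\<^sup>+x. \<rho> x \<partial>mass k (fs k T)) \<le> (\<integral>\<^sup>+x. \<rho> (fh x) * epow (\<rho>h x) k \<partial>mass k T)"
      using bound[OF T] by (intro nn_integral_le_pullback) auto
    then show "\<bar>\<Omega> (fs k T)\<bar> \<le> enn2ereal (\<integral>\<^sup>+x. \<rho> (fh x) * epow (\<rho>h x) k \<partial>mass k T)"
      using \<Omega>_le[OF into[OF T]] by (auto simp: less_eq_ennreal.rep_eq intro: order_trans)
  qed measurable
  moreover have "Lq_loc \<mu> (ennreal p / of_nat k) (\<lambda>x. \<rho> (fh x) * epow (\<rho>h x) k)"
  proof (rule Lq_loc_mult_epow[OF sets_\<mu> _ _ \<rho>h _ \<open>1 \<le> p\<close>])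
    \<comment> \<open>\<open>\<rho>h\<close> itself is only known to agree almost everywhere with a
      minimal weak upper gradient \<open>\<rho>'\<close>, whose definition includes local
      \<open>p\<close>-integrability.\<close>
    obtain \<rho>' where "Lq_loc \<mu> (ennreal p) \<rho>'" "AE x in \<mu>. \<rho>h x = \<rho>' x"
      using grad unfolding represents_gradient_def minimal_weak_upper_gradient_def by blast
    moreover have "\<rho>h \<in> borel_measurable (completion \<mu>)"
      using \<rho>h by (intro measurable_completion) (simp add: measurable_cong_sets[OF sets_\<mu> refl])
    ultimately show "Lq_loc \<mu> (ennreal p) \<rho>h"
      by (intro Lq_loc_AE_cong[of \<mu> _ \<rho>' \<rho>h])
    show "bounded_density (\<lambda>x. \<rho> (fh x))"
      using C unfolding bounded_density_def by blast
  qed measurable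
  moreover have "additive_cochain (reduced_currents \<rho>\<^sub>0 k) (pullback_cochain (fs k) \<Omega>)"
    if "additive_cochain (integral_currents k) \<Omega>"
    using that into add zero_in_reduced_currents by (rule additive_pullback_cochain)
  ultimately show ?thesis by blast
qed

end
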